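(* Let $n\ge 1$, let $G$ be a Young function for which there are constants $p^-,p^+$ with $1\le p^-\le \frac{t\,G'(t)}{G(t)}\le p^+<\infty$ for every $t>0$, let $A\colon\mathbb{R}^n\to\mathbb{R}^n$ be a magnetic potential, and let $s\in(0,1)$ be such that $s<\frac{n}{p^+}$. Then there exists a constant $C=C(n,s,p^\pm)$, depending only on $n,s,p^-,p^+$, such that $$\int_{\mathbb{R}^n}G\left(\frac{|u(x)|}{|x|^s}\right)dx\le C\iint_{\mathbb{R}^n\times\mathbb{R}^n}G\left(\left|\frac{u(x)-e^{\mathrm{i}(x-y)\cdot A\left(\frac{x+y}{2}\right)}u(y)}{|x-y|^s}\right|\right)\frac{dx\,dy}{|x-y|^n}$$ for all $u\in W^{s,G}_{A,0}(\mathbb{R}^n;\mathbb{C})$.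
   Context: Young function: $G\colon[0,\infty)\to[0,\infty)$ of the form $G(t)=\int_0^t\phi(\tau)\,d\tau$, where $\phi\colon[0,\infty)\to[0,\infty)$ satisfies $\phi(0)=0$, $\phi(t)>0$ for $t>0$, $\phi$ is non-decreasing, right-continuous, and $\lim_{t\to+\infty}\phi(t)=+\infty$; $G'$ is understood as $\phi$. Magnetic potential: $A\colon\mathbb{R}^n\to\mathbb{R}^n$ is measurable and locally bounded. For $s\in(0,1)$ and measurable $u\colon\mathbb{R}^n\to\mathbb{C}$ put $$D^A_su(x,y):=\frac{u(x)-e^{\mathrm{i}(x-y)\cdot A\left(\frac{x+y}{2}\right)}u(y)}{|x-y|^s},\qquad I_G(u):=\int_{\mathbb{R}^n}G(|u(x)|)\,dx,\qquad I^A_{s,G}(u):=\iint_{\mathbb{R}^n\times\mathbb{R}^n}G(|D^A_su(x,y)|)\,\frac{dx\,dy}{|x-y|^n},$$ where $\mathrm{i}$ is the imaginary unit. Define $L^G(\mathbb{R}^n;\mathbb{C}):=\{u\colon\mathbb{R}^n\to\mathbb{C}\text{ measurable}: I_G(u)<\infty\}$ and $W^{s,G}_A(\mathbb{R}^n;\mathbb{C}):=\{u\in L^G(\mathbb{R}^n;\mathbb{C}): I^A_{s,G}(u)<\infty\}$ (functions identified when equal a.e.). The magnetic fractional Orlicz seminorm is $|u|^A_{s,G}:=\inf\{\lambda>0: I^A_{s,G}(u/\lambda)\le 1\}$. The space $W^{s,G}_{A,0}(\mathbb{R}^n;\mathbb{C})$ is the closure of $C_0^\infty(\mathbb{R}^n;\mathbb{C})$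 (smooth, compactly supported functions) in $W^{s,G}_A(\mathbb{R}^n;\mathbb{C})$ with respect to the seminorm $|\cdot|^A_{s,G}$. *)

theory Defs
  imports "HOL-Analysis.Analysis"
begin

text \<open>
  Only the values of \<open>\<phi>\<close> and \<open>G\<close> on \<open>[0, \<infinity>)\<close> matter. The density \<open>\<phi>\<close> is carried along
  explicitly because \<open>G'\<close> is understood as \<open>\<phi>\<close> (the right derivative of \<open>G\<close>), also at
  points where \<open>G\<close> is not differentiable.
\<close>

definition young_function :: "(real \<Rightarrow> real) \<Rightarrow> (real \<Rightarrow> real) \<Rightarrow> bool" where
  "young_function G \<phi> \<longleftrightarrow>
     \<phi> 0 = 0 \<and> (\<forall>t>0. \<phi> t > 0) \<and> mono_on {0..} \<phi> \<and>
     (\<forall>t\<ge>0. continuous (at_right t) \<phi>) \<and> filterlim \<phi> at_top at_top \<and>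
     (\<forall>t\<ge>0. (\<phi> has_integral G t) {0..t})"

definition growth_bounds :: "(real \<Rightarrow> real) \<Rightarrow> (real \<Rightarrow> real) \<Rightarrow> real \<Rightarrow> real \<Rightarrow> bool" where
  "growth_bounds G \<phi> pm pp \<longleftrightarrow> (\<forall>t>0. pm \<le> t * \<phi> t / G t \<and> t * \<phi> t / G t \<le> pp)"

definition magnetic_potential :: "(real^'n \<Rightarrow> real^'n) \<Rightarrow> bool" where
  "magnetic_potential A \<longleftrightarrow>
     A \<in> borel_measurable lebesgue \<and> (\<forall>K. compact K \<longrightarrow> bounded (A ` K))"

text \<open>
  On the diagonal \<open>x = y\<close>, a null set of \<open>\<real>\<^sup>n \<times> \<real>\<^sup>n\<close>, the quotients below take the value \<open>0\<close>.
\<close>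

definition mag_quotient ::
  "(real^'n \<Rightarrow> real^'n) \<Rightarrow> real \<Rightarrow> (real^'n \<Rightarrow> complex) \<Rightarrow> real^'n \<Rightarrow> real^'n \<Rightarrow> complex" where
  "mag_quotient A s u x y =
     (u x - exp (\<i> * complex_of_real ((x - y) \<bullet> A ((1/2) *\<^sub>R (x + y)))) * u y)
       / complex_of_real (norm (x - y) powr s)"

definition orlicz_modular :: "(real \<Rightarrow> real) \<Rightarrow> (real^'n \<Rightarrow> complex) \<Rightarrow> ennreal" where
  "orlicz_modular G u = (\<integral>\<^sup>+x. ennreal (G (cmod (u x))) \<partial>lebesgue)"

text \<open>
  The double integral is taken over Lebesgue measure on \<open>\<real>\<^sup>n \<times> \<real>\<^sup>n\<close> rather than over the
  incomplete product \<open>lebesgue \<Otimes>\<^sub>M lebesgue\<close>: for Lebesgue measurable \<open>A\<close> the function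
  \<open>(x, y) \<mapsto> A ((x + y) / 2)\<close> need not be measurable for the latter.
\<close>

definition mag_modular ::
  "(real \<Rightarrow> real) \<Rightarrow> (real^'n \<Rightarrow> real^'n) \<Rightarrow> real \<Rightarrow> (real^'n \<Rightarrow> complex) \<Rightarrow> ennreal" where
  "mag_modular G A s u =
     (\<integral>\<^sup>+(x, y). ennreal (G (cmod (mag_quotient A s u x y)) / norm (x - y) ^ CARD('n))
        \<partial>(lebesgue :: ((real^'n) \<times> (real^'n)) measure))"

text \<open>
  The spaces are sets of functions; every notion involved is invariant under changing a
  function on a null set, so no quotient is formed.
\<close>

definition orlicz_space :: "(real \<Rightarrow> real) \<Rightarrow> (real^'n \<Rightarrow> complex) set" where
  "orlicz_space G = {u \<in> borel_measurable lebesgue. orlicz_modular G u < \<infinity>}"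

definition mag_space ::
  "(real \<Rightarrow> real) \<Rightarrow> (real^'n \<Rightarrow> real^'n) \<Rightarrow> real \<Rightarrow> (real^'n \<Rightarrow> complex) set" where
  "mag_space G A s = {u \<in> orlicz_space G. mag_modular G A s u < \<infinity>}"

text \<open>Extended-valued, so that the infimum of the empty set is \<open>\<infinity>\<close>.\<close>

definition mag_seminorm ::
  "(real \<Rightarrow> real) \<Rightarrow> (real^'n \<Rightarrow> real^'n) \<Rightarrow> real \<Rightarrow> (real^'n \<Rightarrow> complex) \<Rightarrow> ennreal" where
  "mag_seminorm G A s u =
     Inf {ennreal l | l. l > 0 \<and> mag_modular G A s (\<lambda>x. u x / complex_of_real l) \<le> 1}"

text \<open>\<open>C\<^sup>k\<close> by iterated directional derivatives.\<close>

primrec k_smooth :: "nat \<Rightarrow> ('a::real_normed_vector \<Rightarrow> 'b::real_normed_vector) \<Rightarrow> bool" where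
  "k_smooth 0 f \<longleftrightarrow> continuous_on UNIV f"
| "k_smooth (Suc k) f \<longleftrightarrow>
     (\<forall>x. f differentiable (at x)) \<and> (\<forall>v. k_smooth k (\<lambda>x. frechet_derivative f (at x) v))"

definition test_functions :: "(real^'n \<Rightarrow> complex) set" where
  "test_functions = {v. (\<forall>k. k_smooth k v) \<and> compact (closure {x. v x \<noteq> 0})}"

definition mag_space0 ::
  "(real \<Rightarrow> real) \<Rightarrow> (real^'n \<Rightarrow> real^'n) \<Rightarrow> real \<Rightarrow> (real^'n \<Rightarrow> complex) set" where
  "mag_space0 G A s =
     {u \<in> mag_space G A s.
        \<forall>\<epsilon>>0. \<exists>v\<in>test_functions. mag_seminorm G A s (\<lambda>x. u x - v x) < \<epsilon>}"

end

theory Submission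
  imports Defs "HOL-Real_Asymp.Real_Asymp"
begin

text \<open>
  By the diamagnetic inequality it suffices to treat \<open>f = |u|\<close> without magnetic field. For each
  \<open>x\<close>, compare \<open>f x\<close> with \<open>f y\<close> and average over the shell \<open>\<kappa> |x| \<le> |y| < 2 \<kappa> |x|\<close>. As
  \<open>|x - y|\<close>, \<open>|x|\<close> and \<open>|y|\<close> are comparable there, the differences are controlled by the double
  integral, while the terms in \<open>f y\<close> reproduce the left-hand side with a factor of order
  \<open>\<kappa> powr (s * p - n)\<close>; this is at most \<open>1/2\<close> for large \<open>\<kappa>\<close> since \<open>s * p < n\<close>. All \<open>y\<close> in the shell
  lie further out than \<open>x\<close>, so the argument works on \<open>|x| > r\<close>, where the left-hand side is finite
  because \<open>u\<close> lies in the Orlicz space. Hence that term can be absorbed, and \<open>r\<close> sent to \<open>0\<close>,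
  without any approximation by test functions.
\<close>

section \<open>Power growth of Young functions\<close>

text \<open>Since \<open>c powr (-1/m) = 1 - ln c / m + o(1/m)\<close>, this is the classical limit
  of \<open>(1 - x/m) ^ m\<close> with \<open>x = p * ln c\<close>. It turns many small growth steps
  into one power of \<open>c\<close>.\<close>

lemma iterated_growth_limit:
  fixes c p :: real
  assumes "0 < c"
  shows "(\<lambda>N::nat. (1 - p * (1 - c powr (- 1 / real (Suc N)))) ^ Suc N) \<longlonglongrightarrow> c powr (- p)"
proof -
  have "(\<lambda>N::nat. (1 - p * (1 - c powr (- 1 / real (Suc N)))) ^ Suc N) \<longlonglongrightarrow> exp (- (p * ln c))"
    using assms by real_asymp
  then show ?thesis using assms by (simp add: powr_def)
qed

lemma young_growth:
  assumes Y: "young_function G \<phi>" and B: "growth_bounds G \<phi> pm pp" and pm: "1 \<le> pm"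
  shows young_zero: "G 0 = 0"
    and young_pos: "\<And>t. 0 < t \<Longrightarrow> 0 < G t"
    and young_increment: "\<And>a b. 0 \<le> a \<Longrightarrow> a \<le> b \<Longrightarrow> G b - G a \<le> (b - a) * \<phi> b"
    and young_mono: "\<And>a b. 0 \<le> a \<Longrightarrow> a \<le> b \<Longrightarrow> G a \<le> G b"
    and growth_exponent_ge_1: "1 \<le> pp"
proof -
  have int: "\<And>t. 0 \<le> t \<Longrightarrow> (\<phi> has_integral G t) {0..t}"
    and \<phi>pos: "\<And>t. 0 < t \<Longrightarrow> 0 < \<phi> t" and \<phi>0: "\<phi> 0 = 0"
    and \<phi>mono: "\<And>a b. 0 \<le> a \<Longrightarrow> a \<le> b \<Longrightarrow> \<phi> a \<le> \<phi> b"
    using Y by (auto simp: young_function_def mono_on_def)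
  show "G 0 = 0" using int[of 0] has_integral_unique[OF _ has_integral_refl(2)] by simp
  \<comment> \<open>If \<open>G t\<close> were not positive, the quotient in the growth bound would
    be at most 0 (division by 0 gives 0), contrary to \<open>1 \<le> pm\<close>.\<close>
  show pos: "0 < G t" if "0 < t" for t
  proof (rule ccontr)
    assume "\<not> 0 < G t"
    then have "t * \<phi> t / G t \<le> 0" using \<phi>pos[OF that] that by (simp add: divide_nonneg_nonpos)
    moreover have "pm \<le> t * \<phi> t / G t"
      using B that unfolding growth_bounds_def by blast
    ultimately show False using pm by linarith
  qed
  have diff: "(\<phi> has_integral (G b - G a)) {a..b}" if "0 \<le> a" "a \<le> b" for a b
  proof -
    have "\<phi> integrable_on {a..b}"
      using int[of b] that by (meson order.trans integrable_on_subinterval has_integral_integrable atLeastatMost_subset_iff order_refl)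
    then obtain I where I: "(\<phi> has_integral I) {a..b}" by blast
    have "(\<phi> has_integral (G a + I)) {0..b}"
      by (rule has_integral_combine[OF that int I]) (use that in auto)
    then have "G a + I = G b" using int[of b] has_integral_unique that by (metis order.trans)
    then have "I = G b - G a" by simp
    with I show ?thesis by simp
  qed
  show "G b - G a \<le> (b - a) * \<phi> b" if "0 \<le> a" "a \<le> b" for a b
    by (rule has_integral_le[OF diff[OF that], of "\<lambda>_. \<phi> b"])
       (use that \<phi>mono has_integral_const_real[of "\<phi> b" a b] in auto)
  show "G a \<le> G b" if "0 \<le> a" "a \<le> b" for a b
  proof -
    have "0 \<le> G b - G a"
      by (rule has_integral_nonneg[OF diff[OF that]]) (use that \<phi>mono[of 0] \<phi>0 in auto)
    then show ?thesis by simp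
  qed
  have "pm \<le> 1 * \<phi> 1 / G 1 \<and> 1 * \<phi> 1 / G 1 \<le> pp"
    by (rule B[unfolded growth_bounds_def, rule_format]) simp
  with pm show "1 \<le> pp" by linarith
qed

text \<open>The increment of \<open>G\<close> is at most the length of the interval times
  \<open>\<phi>\<close> at its right end, and the growth bound at that end trades
  \<open>\<phi>\<close> for \<open>G\<close>.\<close>

lemma young_growth_step:
  assumes Y: "young_function G \<phi>" and B: "growth_bounds G \<phi> pm pp" and pm: "1 \<le> pm"
    and "0 < t" "1 \<le> q"
  shows "(1 - pp * (1 - 1/q)) * G (q * t) \<le> G t"
proof -
  have qt: "0 < q * t" "t \<le> q * t" using assms by auto
  have "G (q*t) - G t \<le> (q*t - t) * \<phi> (q*t)"
    using young_increment[OF Y B pm] assms qt by simp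
  also have "\<dots> = (1 - 1/q) * (q * t * \<phi> (q*t))" using assms by (simp add: field_simps)
  also have "\<dots> \<le> (1 - 1/q) * (pp * G (q*t))"
  proof (rule mult_left_mono)
    have "q * t * \<phi> (q*t) / G (q*t) \<le> pp" using B qt unfolding growth_bounds_def by blast
    then show "q * t * \<phi> (q*t) \<le> pp * G (q*t)"
      using young_pos[OF Y B pm qt(1)] by (simp add: field_simps)
  qed (use assms in simp)
  finally show ?thesis by (simp add: algebra_simps)
qed

text \<open>
  Since \<open>\<phi>\<close> is only the right derivative of \<open>G\<close>, the growth bound is not integrated as a differential
  inequality for \<open>ln G\<close>; instead the one-step estimate is iterated with ratio \<open>c powr (1/N)\<close>.
\<close>

lemma young_scaling:
  assumes Y: "young_function G \<phi>" and B: "growth_bounds G \<phi> pm pp" and pm: "1 \<le> pm"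
    and t: "0 \<le> t" and c: "1 \<le> c"
  shows "G (c * t) \<le> c powr pp * G t"
proof (cases "t = 0")
  case True then show ?thesis using young_zero[OF Y B pm] by simp
next
  case False
  with t have t: "0 < t" by simp
  define k where "k N = 1 - pp * (1 - c powr (- 1 / real (Suc N)))" for N
  have lim: "(\<lambda>N. k N ^ Suc N) \<longlonglongrightarrow> c powr (- pp)"
    unfolding k_def using iterated_growth_limit c by simp
  \<comment> \<open>\<open>k N\<close> tends to 1. Its sign matters because the induction multiplies
    an inequality by \<open>k N ^ j\<close>.\<close>
  have "eventually (\<lambda>N. 0 \<le> k N) sequentially"
  proof -
    have "eventually (\<lambda>N. 0 < k N) sequentially" unfolding k_def using c by real_asymp
    then show ?thesis by (rule eventually_mono) simp
  qed
  then have "eventually (\<lambda>N. k N ^ Suc N * G (c * t) \<le> G t) sequentially"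
  proof (rule eventually_mono)
    fix N assume k: "0 \<le> k N"
    define q where "q = c powr (1 / real (Suc N))"
    have q: "1 \<le> q" using c by (simp add: q_def ge_one_powr_ge_zero)
    have kq: "k N = 1 - pp * (1 - 1/q)" by (simp add: k_def q_def powr_minus_divide)
    have "k N ^ j * G (q ^ j * t) \<le> G t" for j
    proof (induction j)
      case (Suc j)
      have "k N * G (q * (q ^ j * t)) \<le> G (q ^ j * t)"
        unfolding kq by (rule young_growth_step[OF Y B pm]) (use q t in auto)
      then have "k N ^ j * (k N * G (q * (q ^ j * t))) \<le> k N ^ j * G (q ^ j * t)"
        using k by (intro mult_left_mono) auto
      with Suc show ?case by (simp add: mult_ac)
    qed simp
    from this[of "Suc N"] show "k N ^ Suc N * G (c * t) \<le> G t"
      using c by (simp add: q_def powr_realpow[symmetric] powr_powr del: power_Suc)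
  qed
  then have "c powr (- pp) * G (c * t) \<le> G t"
    by (intro tendsto_upperbound[OF tendsto_mult_right[OF lim]]) auto
  then show ?thesis using c by (simp add: powr_minus field_simps)
qed

section \<open>Shell volumes, the constant, absorption and null sets\<close>

lemma emeasure_annulus:
  fixes a b :: real
  assumes "0 \<le> a" "a \<le> b"
  shows "emeasure lborel {y::'a::euclidean_space. a \<le> norm y \<and> norm y < b} =
         ennreal (unit_ball_vol (DIM('a)) * (b ^ DIM('a) - a ^ DIM('a)))"
proof -
  have "{y::'a. a \<le> norm y \<and> norm y < b} = ball 0 b - ball 0 a" by auto
  moreover have "emeasure lborel (ball (0::'a) b - ball 0 a) = emeasure lborel (ball (0::'a) b) - emeasure lborel (ball (0::'a) a)"
    by (rule emeasure_Diff) (use assms in \<open>auto simp: emeasure_ball\<close>)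
  ultimately show ?thesis
    using assms by (simp add: emeasure_ball ennreal_minus unit_ball_vol_nonneg right_diff_distrib)
qed

text \<open>\<open>2 powr p\<close> is the cost of splitting \<open>H (a + b)\<close>, the powers of
  \<open>3 * \<kappa>\<close> that of exchanging |x| for |x - y| or |y|. The denominator times |x|^N
  is the volume of the shell over which \<open>x\<close> is averaged.\<close>

definition hardy_constant :: "nat \<Rightarrow> real \<Rightarrow> real \<Rightarrow> real \<Rightarrow> real" where
  "hardy_constant N s p \<kappa> = 2 powr p * ((3 * \<kappa>) powr (s * p) * (3 * \<kappa>) ^ N) /
     (unit_ball_vol (real N) * ((2 ^ N - 1) * \<kappa> ^ N))"

text \<open>Finiteness of \<open>J\<close> permits subtracting half of it from both sides; for
  infinite \<open>R\<close> the claim is trivial.\<close>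

lemma ennreal_absorb_half:
  fixes J R :: ennreal
  assumes "J < \<infinity>" "J \<le> R + ennreal \<theta> * J" "\<theta> \<le> 1/2"
  shows "J \<le> 2 * R"
proof (cases R)
  case (real b)
  obtain j where j: "0 \<le> j" "J = ennreal j" using assms(1) by (cases J) auto
  have "J \<le> R + ennreal (1/2) * J"
    using assms(2,3) by (meson add_left_mono ennreal_leI mult_right_mono order_trans zero_le)
  also have "ennreal (1/2) * J = ennreal (j / 2)"
    using j by (subst j(2), subst ennreal_mult[symmetric]) auto
  also have "R + ennreal (j / 2) = ennreal (b + j / 2)"
    using real j by simp
  finally have "j \<le> b + j / 2" using real j by (simp flip: ennreal_plus)
  then have "ennreal j \<le> ennreal (2 * b)" by (intro ennreal_leI) simp
  then show ?thesis using real j by (simp add: ennreal_mult)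
qed simp

lemma exists_small_negative_powr:
  fixes a D :: real
  assumes "a < 0"
  shows "\<exists>\<kappa>>1. D * \<kappa> powr a \<le> 1/2"
proof -
  have "((\<lambda>\<kappa>. D * \<kappa> powr a) \<longlongrightarrow> D * 0) at_top"
    by (intro tendsto_mult_left tendsto_neg_powr assms filterlim_ident)
  then have "eventually (\<lambda>\<kappa>. D * \<kappa> powr a < 1/2) at_top"
    by (rule order_tendstoD) simp
  with eventually_gt_at_top[of 1] have "eventually (\<lambda>\<kappa>. 1 < \<kappa> \<and> D * \<kappa> powr a \<le> 1/2) at_top"
    by eventually_elim auto
  then show ?thesis using eventually_happens'[OF trivial_limit_at_top_linorder] by fast
qed

text \<open>The exceptional pairs lie in \<open>N \<times> UNIV \<union> UNIV \<times> N\<close>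
  with \<open>N\<close> null. This allows |u| to be replaced by a Borel function inside the double
  integral.\<close>

lemma AE_lborel_pair:
  fixes P :: "'a::euclidean_space \<Rightarrow> bool"
  assumes "AE x in lborel. P x"
  shows "AE z in lborel. P (fst z) \<and> P (snd z)"
proof -
  obtain N where N: "N \<in> null_sets lborel" "{x. \<not> P x} \<subseteq> N"
    using assms by (auto simp: eventually_ae_filter)
  have "N \<times> UNIV \<union> UNIV \<times> N \<in> null_sets (lborel \<Otimes>\<^sub>M lborel)"
    using N(1) lborel.times_in_null_sets1[of N lborel UNIV] lborel.times_in_null_sets2[of UNIV lborel N]
    by (intro null_sets.Un) auto
  then show ?thesis
    unfolding lborel_prod by (rule AE_I') (use N(2) in auto)
qed

section \<open>The Hardy inequality without magnetic field\<close>

text \<open>Isolates what the averaging argument takes from a Young function, which enters as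
  \<open>G (max 0 t)\<close>: in this form it is monotone on the whole line, hence Borel.\<close>

locale power_growth =
  fixes H :: "real \<Rightarrow> real" and p :: real
  assumes mono: "mono H" and zero: "H 0 = 0"
    and scaling: "1 \<le> c \<Longrightarrow> 0 \<le> t \<Longrightarrow> H (c * t) \<le> c powr p * H t"
begin

lemma measurable_borel: "H \<in> borel_measurable borel"
  by (rule borel_measurable_mono[OF mono])

lemma nonneg: "0 \<le> t \<Longrightarrow> 0 \<le> H t"
  using monoD[OF mono, of 0 t] zero by simp

text \<open>A substitute for the triangle inequality: the sum is at most twice the maximum, and
  doubling costs \<open>2 powr p\<close>.\<close>

lemma add_le:
  assumes "0 \<le> a" "0 \<le> b"
  shows "H (a + b) \<le> 2 powr p * (H a + H b)"
proof -
  have "H (a + b) \<le> H (2 * max a b)" by (rule monoD[OF mono]) simp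
  also have "\<dots> \<le> 2 powr p * H (max a b)" using assms by (intro scaling) auto
  also have "\<dots> \<le> 2 powr p * (H a + H b)"
    using nonneg[OF assms(1)] nonneg[OF assms(2)] by (intro mult_left_mono) (auto simp: max_def)
  finally show ?thesis .
qed

text \<open>Exchanges one length for a comparable one in the kernel. It is applied with
  \<open>X\<close> = |x|, \<open>Z\<close> = |x - y| or |y|, and
  \<open>K = 3 * \<kappa>\<close>.\<close>

lemma rescale_le:
  assumes "0 \<le> t" "0 < X" "0 < Z" "Z \<le> K * X" "1 \<le> K" "0 \<le> s"
  shows "H (t / X powr s) / X ^ N \<le> K powr (s * p) * K ^ N * (H (t / Z powr s) / Z ^ N)"
proof -
  have "Z powr s \<le> K powr s * X powr s"
    using powr_mono2[of s Z "K * X"] assms by (simp add: powr_mult)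
  then have "t * Z powr s \<le> t * (K powr s * X powr s)"
    using assms by (intro mult_left_mono) auto
  then have "t / X powr s \<le> K powr s * (t / Z powr s)"
    using assms by (simp add: field_simps)
  then have "H (t / X powr s) \<le> H (K powr s * (t / Z powr s))" by (rule monoD[OF mono])
  also have "\<dots> \<le> (K powr s) powr p * H (t / Z powr s)"
    using assms by (intro scaling) (auto simp: ge_one_powr_ge_zero)
  finally have H: "H (t / X powr s) \<le> K powr (s * p) * H (t / Z powr s)"
    by (simp add: powr_powr)
  have "Z ^ N \<le> K ^ N * X ^ N"
    using power_mono[of Z "K * X" N] assms by (simp add: power_mult_distrib)
  then have "1 / X ^ N \<le> K ^ N / Z ^ N" using assms by (simp add: field_simps)
  with H have "H (t / X powr s) * (1 / X ^ N) \<le> K powr (s * p) * H (t / Z powr s) * (K ^ N / Z ^ N)"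
    using nonneg[of "t / X powr s"] nonneg[of "t / Z powr s"] assms by (intro mult_mono) auto
  then show ?thesis by (simp add: field_simps)
qed

text \<open>A pointwise bound on the set \<open>E\<close> of pairs \<open>(x, y)\<close> with
  \<open>y\<close> in the shell of \<open>x\<close> is integrated in both orders: sections at fixed
  \<open>x\<close> have volume \<open>k\<close> |x|^N, those at fixed \<open>y\<close> at most
  \<open>V\<close> (|y|/\<kappa>)^N.\<close>

lemma truncated_hardy:
  fixes f :: "'a::euclidean_space \<Rightarrow> real"
  assumes f [measurable]: "f \<in> borel_measurable borel" and f_nonneg: "\<And>x. 0 \<le> f x"
    and r: "0 < r" and \<kappa>: "1 < \<kappa>" and s: "0 \<le> s"
  defines "C \<equiv> hardy_constant (DIM('a)) s p \<kappa>"
  defines "J \<equiv> (\<integral>\<^sup>+x. ennreal (H (f x / norm x powr s)) * indicator {x. r < norm x} x \<partial>lborel)"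
  shows "J \<le> ennreal C * (\<integral>\<^sup>+z. ennreal (H (\<bar>f (fst z) - f (snd z)\<bar> / norm (fst z - snd z) powr s)
                / norm (fst z - snd z) ^ DIM('a)) \<partial>lborel)
            + ennreal (C * unit_ball_vol (DIM('a)) / \<kappa> ^ DIM('a)) * J"
proof -
  define N where "N = DIM('a)"
  define V where "V = unit_ball_vol (real N)"
  define k where "k = V * ((2 ^ N - 1) * \<kappa> ^ N)"
  define E :: "('a \<times> 'a) set" where
    "E = {z. r < norm (fst z) \<and> \<kappa> * norm (fst z) \<le> norm (snd z) \<and> norm (snd z) < 2 * \<kappa> * norm (fst z)}"
  define Q where "Q = (\<lambda>z::'a\<times>'a. H (\<bar>f (fst z) - f (snd z)\<bar> / norm (fst z - snd z) powr s)
                / norm (fst z - snd z) ^ N)"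
  define h where "h = (\<lambda>x. H (f x / norm x powr s))"
  note measurable_borel [measurable]
  have "{z \<in> space (borel \<Otimes>\<^sub>M borel). r < norm (fst z) \<and> \<kappa> * norm (fst z) \<le> norm (snd z)
      \<and> norm (snd z) < 2 * \<kappa> * norm (fst z)} \<in> sets ((borel :: 'a measure) \<Otimes>\<^sub>M borel)"
    by measurable
  then have [measurable]: "E \<in> sets (borel \<Otimes>\<^sub>M borel)" by (simp add: E_def space_pair_measure)
  have [measurable]: "Q \<in> borel_measurable (borel \<Otimes>\<^sub>M borel)" unfolding Q_def by measurable
  have [measurable]: "h \<in> borel_measurable borel" unfolding h_def by measurable
  have h: "0 \<le> h x" for x unfolding h_def using f_nonneg by (intro nonneg) simp
  have N: "0 < N" by (simp add: N_def)
  have "(1::real) < 2 ^ N" using N by simp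
  moreover have V: "0 < V" by (simp add: V_def unit_ball_vol_pos)
  ultimately have k: "0 < k" using \<kappa> by (simp add: k_def)
  have C: "C = 2 powr p * ((3 * \<kappa>) powr (s * p) * (3 * \<kappa>) ^ N) / k"
    by (simp add: C_def hardy_constant_def k_def V_def N_def)
  then have C0: "0 \<le> C" using k \<kappa> by simp
  \<comment> \<open>The weight is the reciprocal of the shell volume, so integrating over
    \<open>y\<close> is averaging a constant.\<close>
  have inner1: "(\<integral>\<^sup>+y. ennreal (h x / (k * norm x ^ N)) * indicator E (x, y) \<partial>lborel)
      = ennreal (h x) * indicator {x. r < norm x} x" for x
  proof (cases "r < norm x")
    case True
    with r have x: "0 < norm x" by linarith
    have "(\<integral>\<^sup>+y. ennreal (h x / (k * norm x ^ N)) * indicator E (x, y) \<partial>lborel)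
        = (\<integral>\<^sup>+y. ennreal (h x / (k * norm x ^ N)) *
             indicator {y::'a. \<kappa> * norm x \<le> norm y \<and> norm y < 2 * \<kappa> * norm x} y \<partial>lborel)"
      using True by (intro nn_integral_cong) (auto simp: E_def indicator_def)
    also have "\<dots> = ennreal (h x / (k * norm x ^ N)) *
        emeasure lborel {y::'a. \<kappa> * norm x \<le> norm y \<and> norm y < 2 * \<kappa> * norm x}"
      by (rule nn_integral_cmult_indicator) measurable
    also have "\<dots> = ennreal (h x / (k * norm x ^ N)) * ennreal (k * norm x ^ N)"
      using \<kappa> x by (subst emeasure_annulus)
        (auto simp: k_def V_def N_def power_mult_distrib algebra_simps)
    also have "\<dots> = ennreal (h x)"
      using k x h[of x] by (simp flip: ennreal_mult)
    finally show ?thesis using True by simp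
  qed (simp add: E_def)
  \<comment> \<open>Split \<open>f x\<close> into |f x - f y| and \<open>f y\<close>, then exchange
    the denominators, using |x - y| \<le> |x| + |y| \<le> 3 \<kappa> |x|.\<close>
  have pointwise: "h x / (k * norm x ^ N) \<le> C * Q (x, y) + C * (h y / norm y ^ N)"
    if "(x, y) \<in> E" for x y
  proof -
    have "r < norm x" and xy: "\<kappa> * norm x \<le> norm y" "norm y < 2 * \<kappa> * norm x"
      using that by (auto simp: E_def)
    then have x: "0 < norm x" using r by linarith
    have "norm x < \<kappa> * norm x" using \<kappa> x by simp
    with xy have y: "norm x < norm y" by simp
    then have "x \<noteq> y" by auto
    then have z: "0 < norm (x - y)" by simp
    have "norm (x - y) \<le> norm x + norm y" by (rule norm_triangle_ineq4)
    also have "\<dots> \<le> (3 * \<kappa>) * norm x" using xy \<open>norm x < \<kappa> * norm x\<close> by simp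
    finally have z': "norm (x - y) \<le> (3 * \<kappa>) * norm x" .
    have y': "norm y \<le> (3 * \<kappa>) * norm x" using xy \<kappa> x by (simp add: mult_left_mono)
    let ?S = "norm x powr s" and ?M = "(3 * \<kappa>) powr (s * p) * (3 * \<kappa>) ^ N"
    have "h x \<le> H (\<bar>f x - f y\<bar> / ?S + f y / ?S)"
      unfolding h_def by (rule monoD[OF mono]) (simp add: divide_right_mono flip: add_divide_distrib)
    also have "\<dots> \<le> 2 powr p * (H (\<bar>f x - f y\<bar> / ?S) + H (f y / ?S))"
      using f_nonneg by (intro add_le) auto
    finally have "h x / norm x ^ N \<le> 2 powr p * (H (\<bar>f x - f y\<bar> / ?S) + H (f y / ?S)) / norm x ^ N"
      using x by (intro divide_right_mono) auto
    also have "\<dots> = 2 powr p * (H (\<bar>f x - f y\<bar> / ?S) / norm x ^ N + H (f y / ?S) / norm x ^ N)"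
      by (simp add: add_divide_distrib distrib_left)
    also have "\<dots> \<le> 2 powr p * (?M * Q (x, y) + ?M * (h y / norm y ^ N))"
      unfolding Q_def h_def fst_conv snd_conv
      using x y z z' y' \<kappa> s f_nonneg by (intro mult_left_mono add_mono rescale_le) auto
    finally have "h x / norm x ^ N / k \<le> 2 powr p * (?M * Q (x, y) + ?M * (h y / norm y ^ N)) / k"
      using k by (intro divide_right_mono) auto
    then show ?thesis by (simp add: C add_divide_distrib distrib_left mult_ac)
  qed
  have Q: "0 \<le> Q z" for z unfolding Q_def by (intro divide_nonneg_nonneg nonneg) auto
  \<comment> \<open>For fixed \<open>y\<close> the points \<open>x\<close> lie in the ball of radius
    |y|/\<kappa>, which yields the small factor \<open>1 / \<kappa> ^ N\<close>. As |y| > |x| > r on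
    \<open>E\<close>, the right-hand side is again truncated at \<open>r\<close>.\<close>
  have inner2: "(\<integral>\<^sup>+x. ennreal (C * (h y / norm y ^ N)) * indicator E (x, y) \<partial>lborel)
      \<le> ennreal (C * V / \<kappa> ^ N) * (ennreal (h y) * indicator {y. r < norm y} y)" for y
  proof (cases "r < norm y")
    case True
    with r have y: "0 < norm y" by linarith
    have "(\<integral>\<^sup>+x. ennreal (C * (h y / norm y ^ N)) * indicator E (x, y) \<partial>lborel)
       \<le> (\<integral>\<^sup>+x. ennreal (C * (h y / norm y ^ N)) * indicator (cball (0::'a) (norm y / \<kappa>)) x \<partial>lborel)"
      using \<kappa> by (intro nn_integral_mono mult_left_mono) (auto simp: E_def indicator_def field_simps)
    also have "\<dots> = ennreal (C * (h y / norm y ^ N)) * ennreal (V * (norm y / \<kappa>) ^ N)"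
      using \<kappa> by (simp add: nn_integral_cmult_indicator emeasure_cball V_def N_def)
    also have "\<dots> = ennreal (C * V / \<kappa> ^ N) * ennreal (h y)"
      using h[of y] C0 V \<kappa> y by (simp add: field_simps flip: ennreal_mult)
    finally show ?thesis using True by simp
  next
    case False
    have "(x, y) \<notin> E" for x
    proof
      assume "(x, y) \<in> E"
      then have "r < norm x" "\<kappa> * norm x \<le> norm y" by (auto simp: E_def)
      moreover have "1 * norm x \<le> \<kappa> * norm x" using \<kappa> by (intro mult_right_mono) auto
      ultimately show False using False by simp
    qed
    then show ?thesis by simp
  qed
  have "J = (\<integral>\<^sup>+x. \<integral>\<^sup>+y. ennreal (h x / (k * norm x ^ N)) * indicator E (x, y) \<partial>lborel \<partial>lborel)"
    unfolding inner1 by (simp add: J_def h_def)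
  \<comment> \<open>The difference term is enlarged from \<open>E\<close> to all pairs; the other
    term keeps the indicator, on which its smallness rests.\<close>
  also have "\<dots> \<le> (\<integral>\<^sup>+x. \<integral>\<^sup>+y. ennreal C * ennreal (Q (x, y)) +
       ennreal (C * (h y / norm y ^ N)) * indicator E (x, y) \<partial>lborel \<partial>lborel)"
  proof (intro nn_integral_mono)
    fix x y :: 'a
    show "ennreal (h x / (k * norm x ^ N)) * indicator E (x, y) \<le>
       ennreal C * ennreal (Q (x, y)) + ennreal (C * (h y / norm y ^ N)) * indicator E (x, y)"
      using ennreal_leI[OF pointwise[of x y]] C0 Q[of "(x, y)"] h[of y]
      by (cases "(x, y) \<in> E") (simp_all add: ennreal_plus ennreal_mult)
  qed
  also have "\<dots> = ennreal C * (\<integral>\<^sup>+x. \<integral>\<^sup>+y. ennreal (Q (x, y)) \<partial>lborel \<partial>lborel) +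
      (\<integral>\<^sup>+x. \<integral>\<^sup>+y. ennreal (C * (h y / norm y ^ N)) * indicator E (x, y) \<partial>lborel \<partial>lborel)"
    by (simp add: nn_integral_add nn_integral_cmult)
  also have "(\<integral>\<^sup>+x. \<integral>\<^sup>+y. ennreal (Q (x, y)) \<partial>lborel \<partial>lborel) = (\<integral>\<^sup>+z. ennreal (Q z) \<partial>lborel)"
    unfolding lborel_prod[symmetric] by (rule lborel.nn_integral_fst) simp
  also have "(\<integral>\<^sup>+x. \<integral>\<^sup>+y. ennreal (C * (h y / norm y ^ N)) * indicator E (x, y) \<partial>lborel \<partial>lborel)
     = (\<integral>\<^sup>+y. \<integral>\<^sup>+x. ennreal (C * (h y / norm y ^ N)) * indicator E (x, y) \<partial>lborel \<partial>lborel)"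
    by (rule lborel_pair.Fubini'[symmetric]) simp
  also have "\<dots> \<le> (\<integral>\<^sup>+y. ennreal (C * V / \<kappa> ^ N) * (ennreal (h y) * indicator {y. r < norm y} y) \<partial>lborel)"
    by (intro nn_integral_mono inner2)
  also have "\<dots> = ennreal (C * V / \<kappa> ^ N) * J"
    by (simp add: nn_integral_cmult J_def h_def)
  finally show ?thesis by (simp add: Q_def V_def N_def add_left_mono)
qed

lemma hardy:
  fixes f :: "'a::euclidean_space \<Rightarrow> real"
  assumes f [measurable]: "f \<in> borel_measurable borel" and f_nonneg: "\<And>x. 0 \<le> f x"
    and fin: "(\<integral>\<^sup>+x. ennreal (H (f x)) \<partial>lborel) < \<infinity>"
    and \<kappa>: "1 < \<kappa>" "2 powr p * 3 powr (s * p + DIM('a)) * \<kappa> powr (s * p - DIM('a)) \<le> 1/2"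
    and s: "0 \<le> s"
  shows "(\<integral>\<^sup>+x. ennreal (H (f x / norm x powr s)) \<partial>lborel) \<le>
    2 * (ennreal (hardy_constant (DIM('a)) s p \<kappa>) *
      (\<integral>\<^sup>+z. ennreal (H (\<bar>f (fst z) - f (snd z)\<bar> / norm (fst z - snd z) powr s)
                / norm (fst z - snd z) ^ DIM('a)) \<partial>lborel))" (is "_ \<le> 2 * ?R")
proof -
  define h where "h = (\<lambda>x. H (f x / norm x powr s))"
  note measurable_borel [measurable]
  have [measurable]: "h \<in> borel_measurable borel" unfolding h_def by measurable
  define J where "J r = (\<integral>\<^sup>+x. ennreal (h x) * indicator {x. r < norm x} x \<partial>lborel)" for r
  have J_le: "J r \<le> 2 * ?R" if r: "0 < r" for r
  proof (rule ennreal_absorb_half)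
    let ?C = "hardy_constant (DIM('a)) s p \<kappa>" and ?V = "unit_ball_vol (DIM('a))"
    \<comment> \<open>For |x| > r the argument of \<open>H\<close> is at most
      \<open>c * f x\<close>; the maximum with 1 makes \<open>scaling\<close> applicable, so
      \<open>fin\<close> bounds the truncated integral.\<close>
    define c where "c = max 1 (1 / r powr s)"
    have "J r \<le> (\<integral>\<^sup>+x. ennreal (c powr p) * ennreal (H (f x)) \<partial>lborel)"
      unfolding J_def
    proof (rule nn_integral_mono)
      fix x :: 'a
      show "ennreal (h x) * indicator {x. r < norm x} x \<le> ennreal (c powr p) * ennreal (H (f x))"
      proof (cases "r < norm x")
        case True
        have "0 < norm x" using True r by linarith
        then have "f x / norm x powr s \<le> f x / r powr s"
          using True r s f_nonneg by (intro divide_left_mono powr_mono2 mult_pos_pos) auto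
        also have "\<dots> \<le> c * f x"
          using mult_right_mono[of "1 / r powr s" c "f x"] f_nonneg by (simp add: c_def)
        finally have "h x \<le> H (c * f x)" unfolding h_def by (rule monoD[OF mono])
        also have "\<dots> \<le> c powr p * H (f x)"
          using f_nonneg by (intro scaling) (simp_all add: c_def)
        finally show ?thesis
          using True nonneg[OF f_nonneg[of x]] by (simp add: ennreal_leI flip: ennreal_mult)
      qed simp
    qed
    also have "\<dots> = ennreal (c powr p) * (\<integral>\<^sup>+x. ennreal (H (f x)) \<partial>lborel)"
      by (rule nn_integral_cmult) measurable
    also have "\<dots> < \<infinity>" using fin by (simp add: ennreal_mult_less_top)
    finally show "J r < \<infinity>" .
    show "J r \<le> ?R + ennreal (?C * ?V / \<kappa> ^ DIM('a)) * J r"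
      unfolding J_def h_def by (rule truncated_hardy[OF f f_nonneg r \<kappa>(1) s])
    have "(2::real) ^ 1 \<le> 2 ^ DIM('a)" by (rule power_increasing) (auto simp: Suc_le_eq)
    then have "(1::real) \<le> 2 ^ DIM('a) - 1" by simp
    then have "2 powr p * 3 powr (s * p + DIM('a)) * \<kappa> powr (s * p - DIM('a)) / (2 ^ DIM('a) - 1)
      \<le> 2 powr p * 3 powr (s * p + DIM('a)) * \<kappa> powr (s * p - DIM('a)) / 1"
      by (intro divide_left_mono) auto
    \<comment> \<open>The ball volume cancels, and of the powers of \<kappa> there remains
      \<open>s * p + N - 2 * N\<close>, with \<open>N\<close> the dimension.\<close>
    moreover have "?C * ?V / \<kappa> ^ DIM('a) =
      2 powr p * 3 powr (s * p + DIM('a)) * \<kappa> powr (s * p - DIM('a)) / (2 ^ DIM('a) - 1)"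
      using \<kappa>(1) unit_ball_vol_pos[of "DIM('a)"]
      by (simp add: hardy_constant_def powr_mult powr_add powr_diff powr_realpow power_mult_distrib
        less_imp_neq[THEN not_sym]) (simp add: mult_ac)
    ultimately have "?C * ?V / \<kappa> ^ DIM('a) \<le>
      2 powr p * 3 powr (s * p + DIM('a)) * \<kappa> powr (s * p - DIM('a))"
      by simp
    with \<kappa>(2) show "?C * ?V / \<kappa> ^ DIM('a) \<le> 1/2" by linarith
  qed
  \<comment> \<open>Monotone convergence as the truncation radius tends to 0; the bound on
    \<open>J r\<close> is uniform in \<open>r\<close>. The origin is never reached by the
    truncations, but there division by 0 gives \<open>h 0 = H 0 = 0\<close>.\<close>
  have "(\<lambda>i. J (1 / real (Suc i))) \<longlonglongrightarrow> (\<integral>\<^sup>+x. ennreal (h x) \<partial>lborel)"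
    unfolding J_def
  proof (rule nn_integral_LIMSEQ)
    show "incseq (\<lambda>i x. ennreal (h x) * indicator {x. 1 / real (Suc i) < norm x} x)"
      by (intro incseq_SucI le_funI mult_left_mono)
         (auto simp: indicator_def field_simps intro: less_le_trans)
    show "(\<lambda>i. ennreal (h x) * indicator {x. 1 / real (Suc i) < norm x} x) \<longlonglongrightarrow> ennreal (h x)" for x
    proof (cases "x = 0")
      case False
      then have "eventually (\<lambda>i. inverse (real (Suc i)) < norm x) sequentially"
        using LIMSEQ_inverse_real_of_nat by (intro order_tendstoD) auto
      then show ?thesis
        by (intro tendsto_eventually) (auto elim!: eventually_mono simp: inverse_eq_divide)
    qed (simp add: h_def zero)
  qed measurable
  then show ?thesis
    unfolding h_def by (rule LIMSEQ_le_const2) (auto intro!: J_le exI[of _ 0])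
qed

end

section \<open>Passage to the magnetic setting\<close>

text \<open>The phase factor has modulus one, so the reverse triangle inequality applies.\<close>

lemma diamagnetic_inequality:
  "\<bar>cmod (u x) - cmod (u y)\<bar> / norm (x - y) powr s \<le> cmod (mag_quotient A s u x y)"
proof -
  let ?e = "exp (\<i> * complex_of_real ((x - y) \<bullet> A ((1/2) *\<^sub>R (x + y))))"
  have "\<bar>cmod (u x) - cmod (?e * u y)\<bar> \<le> cmod (u x - ?e * u y)" by (rule norm_triangle_ineq3)
  then show ?thesis
    unfolding mag_quotient_def by (simp add: norm_mult norm_divide divide_right_mono)
qed

lemma young_power_growth:
  assumes Y: "young_function G \<phi>" and B: "growth_bounds G \<phi> pm pp" and pm: "1 \<le> pm"
  shows "power_growth (\<lambda>t. G (max 0 t)) pp"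
proof
  show "mono (\<lambda>t. G (max 0 t))"
    by (intro monoI young_mono[OF Y B pm]) auto
  show "G (max 0 0) = 0" using young_zero[OF Y B pm] by simp
  show "G (max 0 (c * t)) \<le> c powr pp * G (max 0 t)" if "1 \<le> c" "0 \<le> t" for c t
    using young_scaling[OF Y B pm that(2,1)] that by simp
qed

lemma magnetic_hardy:
  fixes A :: "real^'n \<Rightarrow> real^'n" and u :: "real^'n \<Rightarrow> complex"
  assumes Y: "young_function G \<phi>" and B: "growth_bounds G \<phi> pm pp" and pm: "1 \<le> pm"
    and u: "u \<in> orlicz_space G" and s: "0 \<le> s"
    and \<kappa>: "1 < \<kappa>" "2 powr pp * 3 powr (s * pp + CARD('n)) * \<kappa> powr (s * pp - CARD('n)) \<le> 1/2"
  shows "(\<integral>\<^sup>+x. ennreal (G (cmod (u x) / norm x powr s)) \<partial>lebesgue)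
    \<le> 2 * (ennreal (hardy_constant (CARD('n)) s pp \<kappa>) * mag_modular G A s u)"
proof -
  define H where "H t = G (max 0 t)" for t
  interpret power_growth H pp
    unfolding H_def [abs_def] by (rule young_power_growth[OF Y B pm])
  have u_meas [measurable]: "u \<in> borel_measurable lebesgue"
    using u by (simp add: orlicz_space_def)
  have u_norm: "(\<lambda>x. cmod (u x)) \<in> borel_measurable lebesgue"
    by measurable
  from completion_ex_borel_measurable_real[OF u_norm]
  obtain g where g [measurable]: "g \<in> borel_measurable lborel"
      and ae_g: "AE x in lborel. cmod (u x) = g x"
    by auto
  \<comment> \<open>The Borel representative \<open>g\<close> of |u| may be negative on a null set;
    \<open>hardy\<close> asks for a function that is nonnegative everywhere.\<close>
  define f where "f x = max 0 (g x)" for x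
  have f: "f \<in> borel_measurable borel"
    using g unfolding f_def by simp
  have f_nonneg: "0 \<le> f x" for x
    by (auto simp: f_def)
  have ae: "AE x in lborel. cmod (u x) = f x"
    using ae_g
  proof eventually_elim
    case (elim x) then show ?case using norm_ge_zero[of "u x"] by (simp add: f_def)
  qed
  have "(\<integral>\<^sup>+x. ennreal (H (f x)) \<partial>lborel) = orlicz_modular G u"
    unfolding orlicz_modular_def nn_integral_completion
    by (rule nn_integral_cong_AE) (use ae in eventually_elim, simp add: f_nonneg H_def)
  then have fin: "(\<integral>\<^sup>+x. ennreal (H (f x)) \<partial>lborel) < \<infinity>"
    using u by (simp add: orlicz_space_def)
  let ?Q = "\<lambda>z. ennreal (H (\<bar>f (fst z) - f (snd z)\<bar> / norm (fst z - snd z) powr s)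
                / norm (fst z - snd z) ^ DIM(real^'n))"
  have Q_le: "(\<integral>\<^sup>+z. ?Q z \<partial>lborel) \<le> mag_modular G A s u"
    unfolding mag_modular_def nn_integral_completion
  proof (rule nn_integral_mono_AE, use AE_lborel_pair[OF ae] in eventually_elim)
    fix z :: "(real^'n) \<times> (real^'n)"
    assume eq: "cmod (u (fst z)) = f (fst z) \<and> cmod (u (snd z)) = f (snd z)"
    have "H (\<bar>f (fst z) - f (snd z)\<bar> / norm (fst z - snd z) powr s)
        \<le> G (cmod (mag_quotient A s u (fst z) (snd z)))"
      unfolding H_def using diamagnetic_inequality[of u "fst z" "snd z" s A] eq
      by (intro young_mono[OF Y B pm]) simp_all
    then show "?Q z \<le> (case z of (x, y) \<Rightarrow>
        ennreal (G (cmod (mag_quotient A s u x y)) / norm (x - y) ^ CARD('n)))"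
      by (auto simp: case_prod_beta intro!: ennreal_leI divide_right_mono)
  qed
  have "(\<integral>\<^sup>+x. ennreal (G (cmod (u x) / norm x powr s)) \<partial>lebesgue) =
      (\<integral>\<^sup>+x. ennreal (H (f x / norm x powr s)) \<partial>lborel)"
    unfolding nn_integral_completion
  proof (rule nn_integral_cong_AE, use ae in eventually_elim)
    fix x assume "cmod (u x) = f x"
    moreover have "max 0 (f x / norm x powr s) = f x / norm x powr s"
      using f_nonneg by (intro max_absorb2) simp
    ultimately show "ennreal (G (cmod (u x) / norm x powr s)) = ennreal (H (f x / norm x powr s))"
      by (simp only: H_def)
  qed
  also have "\<dots> \<le>
      2 * (ennreal (hardy_constant (DIM(real^'n)) s pp \<kappa>) * (\<integral>\<^sup>+z. ?Q z \<partial>lborel))"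
    by (rule hardy[OF f f_nonneg fin \<kappa>(1) _ s]) (use \<kappa>(2) in simp)
  also have "\<dots> \<le> 2 * (ennreal (hardy_constant (DIM(real^'n)) s pp \<kappa>) * mag_modular G A s u)"
    by (intro mult_left_mono Q_le) simp_all
  finally show ?thesis by simp
qed

section \<open>Choice of a constant uniform in the Young function, the potential and
  \<open>u\<close>\<close>

theorem theorem1p2:
  fixes s pm pp :: real
  assumes "0 < s" "s < 1" "1 \<le> pm" "s < real CARD('n::finite) / pp"
  shows "\<exists>C::real. C > 0 \<and> (\<forall>(G :: real \<Rightarrow> real) (\<phi> :: real \<Rightarrow> real) (A :: real^'n \<Rightarrow> real^'n).
           young_function G \<phi> \<longrightarrow> growth_bounds G \<phi> pm pp \<longrightarrow> magnetic_potential A \<longrightarrow>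
           (\<forall>u \<in> mag_space0 G A s.
              (\<integral>\<^sup>+x. ennreal (G (cmod (u x) / norm x powr s)) \<partial>lebesgue)
                \<le> ennreal C * mag_modular G A s u))"
proof (cases "1 \<le> pp")
  \<comment> \<open>The constant precedes the choice of \<open>G\<close>, so
    \<open>1 \<le> pp\<close> cannot yet be drawn from a growth bound. In this case
    \<open>pp\<close> is positive and \<open>s < n / pp\<close> makes the exponent of \<kappa>
    negative.\<close>
  case True
  then have "s * pp - CARD('n) < 0" using assms by (simp add: field_simps)
  from exists_small_negative_powr[OF this, of "2 powr pp * 3 powr (s * pp + CARD('n))"]
  obtain \<kappa> where \<kappa>: "1 < \<kappa>"
    "2 powr pp * 3 powr (s * pp + CARD('n)) * \<kappa> powr (s * pp - CARD('n)) \<le> 1/2"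
    by blast
  let ?C = "hardy_constant (CARD('n)) s pp \<kappa>"
  have "(1::real) < 2 ^ CARD('n)" by simp
  then have C: "0 < ?C"
    using \<kappa>(1) unfolding hardy_constant_def
    by (intro divide_pos_pos mult_pos_pos) (auto simp: unit_ball_vol_pos)
  \<comment> \<open>\<kappa> was fixed from \<open>n\<close>, \<open>s\<close> and \<open>pp\<close>
    alone; the factor 2 comes from the absorption.\<close>
  show ?thesis
  proof (intro exI[of _ "2 * ?C"] conjI allI impI ballI)
    fix G \<phi> :: "real \<Rightarrow> real" and A :: "real^'n \<Rightarrow> real^'n" and u
    assume "young_function G \<phi>" "growth_bounds G \<phi> pm pp" "u \<in> mag_space0 G A s"
    then have "(\<integral>\<^sup>+x. ennreal (G (cmod (u x) / norm x powr s)) \<partial>lebesgue)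
        \<le> 2 * (ennreal ?C * mag_modular G A s u)"
      using assms \<kappa> by (intro magnetic_hardy) (auto simp: mag_space0_def mag_space_def)
    then show "(\<integral>\<^sup>+x. ennreal (G (cmod (u x) / norm x powr s)) \<partial>lebesgue)
        \<le> ennreal (2 * ?C) * mag_modular G A s u"
      using C by (simp add: ennreal_mult mult.assoc)
  qed (use C in simp)
next
  case False \<comment> \<open>Then no Young function satisfies the growth bounds.\<close>
  then have "\<not> (young_function G \<phi> \<and> growth_bounds G \<phi> pm pp)" for G \<phi>
    using growth_exponent_ge_1[of G \<phi> pm pp] \<open>1 \<le> pm\<close> by blast
  then show ?thesis by (intro exI[of _ 1]) simp
qed

end
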